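(* Let $H>0$. The spacelike surfaces of revolution in $\mathbb E_1^3$ with constant mean curvature $H$ whose axis of revolution is a timelike axis (the $z$-axis), i.e. the surfaces $$T(s,\theta)=(x(s)\cos\theta,\;x(s)\sin\theta,\;z(s)),\qquad s\in I,\ \theta\in(0,2\pi),$$ with generating curve $$(x(s),z(s))=\left(\frac{1}{2H}\sqrt{2B\cosh 2Hs-B^2-1},\ \int_0^s\frac{1-B\cosh 2Ht}{\sqrt{2B\cosh 2Ht-B^2-1}}\,dt\right),$$ for $B\in(0,\infty)\setminus\{1\}$, cannot be algebraic except spacelike cylinders and standard hyperboloids.
   Context: $\mathbb E_1^3$ denotes the Lorentz-Minkowski space $(\mathbb R^3,\,dx^2+dy^2-dz^2)$. A surface $S$ in $\mathbb R^3$ is algebraic if it can be expressed as the zero set of some polynomial $P$, i.e. $S=P^{-1}(0)=\{(x,y,z)\in\mathbb R^3: P(x,y,z)=0\}$. The generating curve $(x(s),0,z(s))$, $s\in I$, with $I$ an open interval, is a smooth spacelike curve in the $xz$-plane parametrized by arc length, so $x'(s)^2-z'(s)^2=1$, with $x(s)>0$ on $I$. The surfaces of revolution of constant mean curvature $H$ are classified by a non-negative real parameter $B$. Those with $0<B<1$ are called spacelike unduloids and those with $B>1$ spacelike nodoids. The value $B=0$ corresponds to a spacelike cylinder (for the timelike axis, an imaginary one, $x^2+y^2=-\frac{1}{4H^2}$), and $B=1$ corresponds to the standard hyperboloid $x^2+y^2-z^2=-\frac{1}{H^2}$.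
   Formalization: The integral from 0 is undefined, since the radicand at 0 is -(B-1)^2 < 0; z(s) is instead taken as c plus the integral from a to s, for any a in I and any real constant c (a translation along the axis). *)

theory Defs
  imports "HOL-Analysis.Analysis" "HOL-Computational_Algebra.Polynomial"
begin

text \<open>
  Polynomials in three real variables are elements of the iterated polynomial ring
  $\mathbb{R}[x][y][z]$; the outermost variable is \<open>z\<close>.
\<close>
definition poly3 :: "real poly poly poly \<Rightarrow> real ^ 3 \<Rightarrow> real" where
  "poly3 P p = poly (poly (poly P [:[:p $ 3:]:]) [:p $ 2:]) (p $ 1)"

text \<open>
  The zero polynomial is excluded: its zero set is the whole space, which is not a surface.
\<close>
definition algebraic_surface :: "(real ^ 3) set \<Rightarrow> bool" where
  "algebraic_surface S \<longleftrightarrow> (\<exists>P. P \<noteq> 0 \<and> S = {p. poly3 P p = 0})"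

definition rotation_surface ::
  "(real \<Rightarrow> real) \<Rightarrow> (real \<Rightarrow> real) \<Rightarrow> real set \<Rightarrow> (real ^ 3) set" where
  "rotation_surface x z I =
     (\<lambda>(s, \<theta>). vector [x s * cos \<theta>, x s * sin \<theta>, z s]) ` (I \<times> {0<..<2 * pi})"

text \<open>
  Since \<open>sqrt\<close> is an odd function on the reals here, \<open>profile_x H B s > 0\<close> (for \<open>H > 0\<close>)
  says exactly that the radicand is positive.
\<close>
definition profile_x :: "real \<Rightarrow> real \<Rightarrow> real \<Rightarrow> real" where
  "profile_x H B s = 1 / (2 * H) * sqrt (2 * B * cosh (2 * H * s) - B\<^sup>2 - 1)"

text \<open>
  At \<open>s = 0\<close> the radicand is $-(B-1)^2$, so for \<open>B \<noteq> 1\<close> the real curve never has \<open>0\<close> in its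
  parameter interval and the integral cannot start there.  The lower limit is therefore a
  base point \<open>a\<close>, to be taken in the parameter interval, and the height \<open>c\<close> at \<open>a\<close> is kept as a
  free constant of integration (a translation along the axis).
\<close>
definition profile_z :: "real \<Rightarrow> real \<Rightarrow> real \<Rightarrow> real \<Rightarrow> real \<Rightarrow> real" where
  "profile_z H B a c s = c + (LBINT t=ereal a..ereal s.
     (1 - B * cosh (2 * H * t)) / sqrt (2 * B * cosh (2 * H * t) - B\<^sup>2 - 1))"

end

theory Submission
  imports Defs "HOL-Complex_Analysis.Complex_Analysis"
begin

text \<open>
  The height of the profile curve, as a function of the radius, is an elliptic integral with a nonzero
  period along which the radius returns to its value.  Such a function takes infinitely many
  values over one radius after analytic continuation, and so satisfies no polynomial relation.

  Concretely, write the radius as \<open>x = \<bar>1 - B\<bar> / (2 * H) * sinh \<tau>\<close>.  Then, up to sign, \<open>2 * H\<close> times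
  the height is a constant plus a primitive \<open>F\<close> of
  $$\frac{(1 - B^2) - (1 - B)^2 \sinh^2 \tau}{\sqrt{(1 + B)^2 + (1 - B)^2 \sinh^2 \tau}}$$
  (\<open>profile_in_elliptic_coordinates\<close>).  The primitive extends to complex \<open>\<tau>\<close> in a cross-shaped domain
  made of a horizontal strip around the real axis and a vertical strip around the imaginary axis.
  In the vertical strip, \<open>F (w + 2 * pi * \<i>) = F w + K\<close> with \<open>K \<noteq> 0\<close>
  (\<open>elliptic_primitive_with_period\<close>), while \<open>sinh\<close> is periodic.

  Suppose now that a polynomial \<open>P\<close> vanishes on the surface.  For each fixed angle \<open>\<theta>\<close>, the relation
  \<open>P (x * cos \<theta>, x * sin \<theta>, z) = 0\<close> is analytic in \<open>\<tau>\<close> and persists on the cross.  Translating by the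
  period gives infinitely many heights over the same horizontal point, so \<open>P\<close> vanishes on whole vertical
  lines; these lines are plentiful enough to force \<open>P = 0\<close>
  (\<open>relation_with_quasi_periodic_height_is_trivial\<close>).

  A short piece of the profile curve starting at \<open>a\<close> suffices for the argument.  Hence no set containing
  the surface is algebraic, and in particular the surface itself is not.
\<close>

section \<open>Polynomials in three variables\<close>

lemma poly3_eq_sum:
  "poly3 P (vector [x, y, z]) =
    (\<Sum>k\<le>degree P. (\<Sum>j\<le>degree (coeff P k).
      (\<Sum>i\<le>degree (coeff (coeff P k) j). coeff (coeff (coeff P k) j) i * x ^ i) * y ^ j) * z ^ k)"
  by (simp add: poly3_def poly_altdef[of P] poly_sum poly_altdef[of "coeff _ _"])

lemma poly3_vanishing_on_box_is_zero:
  assumes "infinite A" "infinite B" "infinite C"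
    and zero: "\<And>x y z. x \<in> A \<Longrightarrow> y \<in> B \<Longrightarrow> z \<in> C \<Longrightarrow> poly3 P (vector [x, y, z]) = 0"
  shows "P = 0"
proof -
  have z: "poly P [:[:z:]:] = 0" if "z \<in> C" for z
  proof -
    have y: "poly (poly P [:[:z:]:]) [:y:] = 0" if "y \<in> B" for y
    proof (rule ccontr)
      assume "\<not> ?thesis"
      then have "finite {x. poly (poly (poly P [:[:z:]:]) [:y:]) x = 0}"
        by (rule poly_roots_finite)
      moreover have "A \<subseteq> {x. poly (poly (poly P [:[:z:]:]) [:y:]) x = 0}"
        using zero \<open>y \<in> B\<close> \<open>z \<in> C\<close> by (auto simp: poly3_def)
      ultimately show False using \<open>infinite A\<close> finite_subset by blast
    qed
    show ?thesis
    proof (rule ccontr)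
      assume "\<not> ?thesis"
      then have "finite {q. poly (poly P [:[:z:]:]) q = 0}"
        by (rule poly_roots_finite)
      moreover have "(\<lambda>y. [:y:]) ` B \<subseteq> {q. poly (poly P [:[:z:]:]) q = 0}"
        using y by auto
      moreover have "infinite ((\<lambda>y::real. [:y:]) ` B)"
        using \<open>infinite B\<close> by (subst finite_image_iff) (auto simp: inj_on_def)
      ultimately show False using finite_subset by blast
    qed
  qed
  show ?thesis
  proof (rule ccontr)
    assume "\<not> ?thesis"
    then have "finite {q. poly P q = 0}"
      by (rule poly_roots_finite)
    moreover have "(\<lambda>z. [:[:z:]:]) ` C \<subseteq> {q. poly P q = 0}"
      using z by auto
    moreover have "infinite ((\<lambda>z::real. [:[:z:]:]) ` C)"
      using \<open>infinite C\<close> by (subst finite_image_iff) (auto simp: inj_on_def)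
    ultimately show False using finite_subset by blast
  qed
qed

text \<open>
  The same polynomial evaluated at complex points, so that a relation known on the real surface can
  be continued analytically.
\<close>
definition cpoly3 :: "real poly poly poly \<Rightarrow> complex \<Rightarrow> complex \<Rightarrow> complex \<Rightarrow> complex" where
  "cpoly3 P x y z =
    (\<Sum>k\<le>degree P. (\<Sum>j\<le>degree (coeff P k).
      (\<Sum>i\<le>degree (coeff (coeff P k) j). of_real (coeff (coeff (coeff P k) j) i) * x ^ i) * y ^ j) * z ^ k)"

lemma cpoly3_of_real:
  "cpoly3 P (of_real x) (of_real y) (of_real z) = of_real (poly3 P (vector [x, y, z]))"
  by (simp add: cpoly3_def poly3_eq_sum)

lemma holomorphic_on_cpoly3:
  assumes "f holomorphic_on S" "g holomorphic_on S" "h holomorphic_on S"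
  shows "(\<lambda>w. cpoly3 P (f w) (g w) (h w)) holomorphic_on S"
  unfolding cpoly3_def by (intro holomorphic_intros assms)

lemma cpoly3_eq_0_if_infinitely_many_zeros:
  assumes "infinite {z. cpoly3 P x y z = 0}"
  shows "cpoly3 P x y z = 0"
proof -
  have "\<forall>k\<le>degree P. (\<Sum>j\<le>degree (coeff P k).
      (\<Sum>i\<le>degree (coeff (coeff P k) j). of_real (coeff (coeff (coeff P k) j) i) * x ^ i) * y ^ j) = 0"
    using assms unfolding cpoly3_def by (subst (asm) Transcendental.polyfun_finite_roots) auto
  then show ?thesis by (simp add: cpoly3_def)
qed

section \<open>The elliptic integral and its imaginary period\<close>

text \<open>
  The horizontal strip carries the real axis, where the profile curve lives; the vertical strip
  carries the translations by \<open>2 * pi * \<i>\<close>.  Their union is starlike about 0, hence has primitives.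
\<close>
definition cross :: "real \<Rightarrow> complex set" where
  "cross r = {w. \<bar>Re w\<bar> < r \<or> \<bar>Im w\<bar> < pi / 4}"

lemma open_cross: "open (cross r)"
  unfolding cross_def
  by (intro open_Collect_disj open_Collect_less continuous_intros)

lemma starlike_cross:
  assumes "r > 0"
  shows "starlike (cross r)"
  unfolding starlike_def
proof (intro bexI ballI subsetI)
  show "0 \<in> cross r" using assms by (simp add: cross_def)
  fix w v assume w: "w \<in> cross r" and "v \<in> closed_segment 0 w"
  then obtain t where t: "0 \<le> t" "t \<le> 1" "v = t *\<^sub>R w"
    by (auto simp: closed_segment_def)
  have "\<bar>Re v\<bar> \<le> \<bar>Re w\<bar>" "\<bar>Im v\<bar> \<le> \<bar>Im w\<bar>"
    using t by (auto simp: abs_mult mult_left_le_one_le)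
  then show "v \<in> cross r" using w by (auto simp: cross_def)
qed

lemma Re_sinh_squared: "Re ((sinh w)\<^sup>2) = (cosh (2 * Re w) * cos (2 * Im w) - 1) / 2"
proof -
  have "Re (cosh (2 * w)) = cosh (2 * Re w) * cos (2 * Im w)"
    by (simp add: cosh_conv_cos Re_cos cosh_field_def)
  moreover have "Re ((sinh w)\<^sup>2) = Re ((cosh (2 * w) - 1) / 2)"
    by (simp only: cosh_double_cosh sinh_square_eq) simp
  ultimately show ?thesis by simp
qed

text \<open>
  The branch points satisfy \<open>(sinh w)\<^sup>2 = - (a / b)\<^sup>2\<close>; they lie on the lines
  \<open>Im w = pi / 2 + k * pi\<close> at distance \<open>arcosh (a / b)\<close> from the imaginary axis.  The cross fits
  between them, and on it the radicand stays in the right half plane, away from the cut of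
  \<open>csqrt\<close>.
\<close>
lemma Re_radicand_pos:
  fixes a b :: real
  assumes "0 < b" "b < a" and w: "w \<in> cross (arcosh (a / b))"
  shows "Re (of_real (a\<^sup>2) + of_real (b\<^sup>2) * (sinh w)\<^sup>2) > 0"
proof -
  define C where "C = cosh (2 * Re w)"
  define c where "c = cos (2 * Im w)"
  have C: "C > 0" by (simp add: C_def)
  have "b\<^sup>2 * ((1 - C * c) / 2) < a\<^sup>2"
  proof (cases "\<bar>Re w\<bar> < arcosh (a / b)")
    case True
    \<comment> \<open>In the vertical strip the worst case is \<open>c = - 1\<close>, where the bound becomes \<open>b * cosh (Re w) < a\<close>.\<close>
    have "cosh \<bar>Re w\<bar> < cosh (arcosh (a / b))"
      using True assms by (subst cosh_real_nonneg_less_iff) auto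
    then have "cosh (Re w) < a / b" using assms by simp
    then have "b * cosh (Re w) < a" using assms by (simp add: field_simps)
    then have "(b * cosh (Re w))\<^sup>2 < a\<^sup>2"
      using assms by (intro power_strict_mono) auto
    moreover have "(b * cosh (Re w))\<^sup>2 = b\<^sup>2 * ((1 + C) / 2)"
      unfolding C_def cosh_double_cosh by (simp add: power_mult_distrib)
    moreover have "- C \<le> C * c"
      using mult_left_mono[of "-1" c C] C by (simp add: c_def)
    then have "b\<^sup>2 * ((1 - C * c) / 2) \<le> b\<^sup>2 * ((1 + C) / 2)"
      by (intro mult_left_mono) simp_all
    ultimately show ?thesis by linarith
  next
    case False
    \<comment> \<open>In the horizontal strip \<open>c > 0\<close>, so the radicand has real part at least \<open>a\<^sup>2 - b\<^sup>2 / 2\<close>.\<close>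
    then have "\<bar>Im w\<bar> < pi / 4" using w by (simp add: cross_def)
    then have "c > 0" unfolding c_def by (intro cos_gt_zero_pi) auto
    then have "C * c > 0" using C by simp
    then have "b\<^sup>2 * ((1 - C * c) / 2) \<le> b\<^sup>2 * 1"
      by (intro mult_left_mono) simp_all
    moreover have "b\<^sup>2 < a\<^sup>2" using assms by (simp add: power_strict_mono)
    ultimately show ?thesis by linarith
  qed
  moreover have "Re (of_real (a\<^sup>2) + of_real (b\<^sup>2) * (sinh w)\<^sup>2) = a\<^sup>2 + b\<^sup>2 * Re ((sinh w)\<^sup>2)"
    by (simp only: plus_complex.sel times_complex.sel Re_complex_of_real Im_complex_of_real)
  moreover have "b\<^sup>2 * Re ((sinh w)\<^sup>2) = - (b\<^sup>2 * ((1 - C * c) / 2))"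
    unfolding Re_sinh_squared C_def c_def by (simp add: field_simps)
  ultimately show ?thesis by linarith
qed

text \<open>
  With \<open>u = b * sinh w\<close> this is the integrand of the elliptic integral
  $\int (c - u^2) / \sqrt{(u^2 + a^2)(u^2 + b^2)}\,du$: the substitution removes the factor
  $u^2 + b^2 = b^2 \cosh^2 w$, and with it the branch points at $u = \pm i b$.
\<close>
definition elliptic_integrand :: "real \<Rightarrow> real \<Rightarrow> real \<Rightarrow> complex \<Rightarrow> complex" where
  "elliptic_integrand a b c w =
    (of_real c - of_real (b\<^sup>2) * (sinh w)\<^sup>2) / csqrt (of_real (a\<^sup>2) + of_real (b\<^sup>2) * (sinh w)\<^sup>2)"

lemma holomorphic_on_sinh: "(sinh :: complex \<Rightarrow> complex) holomorphic_on S"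
proof -
  have "(\<lambda>z. - \<i> * sin (\<i> * z)) holomorphic_on S" by (intro holomorphic_intros)
  then show ?thesis by (simp add: sinh_conv_sin[abs_def])
qed

lemma holomorphic_on_elliptic_integrand:
  assumes "0 < b" "b < a"
  shows "elliptic_integrand a b c holomorphic_on cross (arcosh (a / b))"
proof -
  have *: "of_real (a\<^sup>2) + of_real (b\<^sup>2) * (sinh w)\<^sup>2 \<notin> \<real>\<^sub>\<le>\<^sub>0" if "w \<in> cross (arcosh (a / b))" for w :: complex
    using Re_radicand_pos[OF assms that] by (auto simp only: complex_nonpos_Reals_iff)
  have 0: "of_real (a\<^sup>2) + of_real (b\<^sup>2) * (sinh w)\<^sup>2 \<noteq> 0" if "w \<in> cross (arcosh (a / b))" for w :: complex
    using *[OF that] by auto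
  show ?thesis
    unfolding elliptic_integrand_def
    by (intro holomorphic_intros holomorphic_on_sinh *) (use 0 in auto)
qed

lemma sinh_plus_2pi_i: "sinh (w + 2 * of_real pi * \<i>) = sinh w"
proof -
  have "\<i> * (w + 2 * of_real pi * \<i>) = \<i> * w - of_real (2 * pi)"
    by (simp add: algebra_simps)
  then show ?thesis
    unfolding sinh_conv_sin by (simp only: sin_diff sin_of_real cos_of_real) simp
qed

lemma elliptic_integrand_periodic:
  "elliptic_integrand a b c (w + 2 * of_real pi * \<i>) = elliptic_integrand a b c w"
  by (simp only: elliptic_integrand_def sinh_plus_2pi_i)

lemma sinh_of_real: "sinh (of_real t :: complex) = of_real (sinh t)"
  by (simp add: sinh_field_def exp_of_real flip: of_real_minus)

lemma elliptic_integrand_of_real: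
  "elliptic_integrand a b c (of_real t) =
    of_real ((c - b\<^sup>2 * (sinh t)\<^sup>2) / sqrt (a\<^sup>2 + b\<^sup>2 * (sinh t)\<^sup>2))"
proof -
  have "of_real (a\<^sup>2) + of_real (b\<^sup>2) * (sinh (of_real t))\<^sup>2 = complex_of_real (a\<^sup>2 + b\<^sup>2 * (sinh t)\<^sup>2)"
    by (simp add: sinh_of_real)
  moreover have "csqrt (complex_of_real (a\<^sup>2 + b\<^sup>2 * (sinh t)\<^sup>2)) = of_real (sqrt (a\<^sup>2 + b\<^sup>2 * (sinh t)\<^sup>2))"
    by (rule of_real_sqrt[symmetric]) auto
  ultimately show ?thesis
    unfolding elliptic_integrand_def by (simp add: sinh_of_real)
qed

lemma elliptic_integrand_imaginary:
  assumes "0 < b" "b < a"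
  shows "elliptic_integrand a b c (\<i> * of_real t) =
    of_real ((c + b\<^sup>2 * (sin t)\<^sup>2) / sqrt (a\<^sup>2 - b\<^sup>2 * (sin t)\<^sup>2))"
    and "a\<^sup>2 - b\<^sup>2 * (sin t)\<^sup>2 > 0"
proof -
  have "b\<^sup>2 * (sin t)\<^sup>2 \<le> b\<^sup>2 * 1"
    by (intro mult_left_mono) (auto simp: abs_square_le_1)
  also have "\<dots> < a\<^sup>2" using assms by (simp add: power_strict_mono)
  finally show *: "a\<^sup>2 - b\<^sup>2 * (sin t)\<^sup>2 > 0" by simp
  have s: "(sinh (\<i> * of_real t))\<^sup>2 = - of_real ((sin t)\<^sup>2)"
    by (simp add: sinh_conv_sin power_mult_distrib sin_of_real flip: mult.assoc)
  have "of_real (a\<^sup>2) + of_real (b\<^sup>2) * (sinh (\<i> * of_real t))\<^sup>2 = complex_of_real (a\<^sup>2 - b\<^sup>2 * (sin t)\<^sup>2)"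
    unfolding s by simp
  moreover have "csqrt (complex_of_real (a\<^sup>2 - b\<^sup>2 * (sin t)\<^sup>2)) = of_real (sqrt (a\<^sup>2 - b\<^sup>2 * (sin t)\<^sup>2))"
    using * by (intro of_real_sqrt[symmetric]) auto
  ultimately show "elliptic_integrand a b c (\<i> * of_real t) =
    of_real ((c + b\<^sup>2 * (sin t)\<^sup>2) / sqrt (a\<^sup>2 - b\<^sup>2 * (sin t)\<^sup>2))"
    unfolding elliptic_integrand_def by (simp add: s)
qed

text \<open>
  The increment of a primitive over \<open>2 * pi * \<i>\<close> is constant because the integrand is periodic.  It
  cannot vanish: on the imaginary axis the integrand is real and, by the hypothesis on its numerator,
  never zero, so Rolle's theorem forbids \<open>Im F\<close> to take equal values at the two ends of the period.
\<close>
lemma elliptic_primitive_with_period: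
  fixes a b c :: real
  assumes ab: "0 < b" "b < a" and c: "\<And>t. c + b\<^sup>2 * (sin t)\<^sup>2 \<noteq> 0"
  obtains r K F where "r > 0" "K \<noteq> 0"
    "\<forall>w\<in>cross r. (F has_field_derivative elliptic_integrand a b c w) (at w)"
    "\<forall>w. \<bar>Re w\<bar> < r \<longrightarrow> F (w + 2 * of_real pi * \<i>) = F w + K"
proof -
  define r where "r = arcosh (a / b)"
  have r: "r > 0" unfolding r_def using ab by simp
  have "elliptic_integrand a b c holomorphic_on cross r"
    unfolding r_def by (rule holomorphic_on_elliptic_integrand[OF ab])
  then obtain F where F: "\<And>w. w \<in> cross r \<Longrightarrow> (F has_field_derivative elliptic_integrand a b c w) (at w)"
    using holomorphic_starlike_primitive[OF _ starlike_cross[OF r] open_cross finite.emptyI]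
    by (metis Diff_empty holomorphic_on_imp_continuous_on holomorphic_on_imp_differentiable_at open_cross)
  define V where "V = {w. \<bar>Re w\<bar> < r}"
  have "V = {w. Re w < r} \<inter> {w. Re w > - r}" by (auto simp: V_def)
  then have "convex V" by (simp add: convex_Int convex_halfspace_Re_lt convex_halfspace_Re_gt)
  moreover have "((\<lambda>w. F (w + 2 * of_real pi * \<i>) - F w) has_field_derivative 0) (at w within V)"
    if "w \<in> V" for w
  proof -
    have "w \<in> cross r" "w + 2 * of_real pi * \<i> \<in> cross r"
      using that by (auto simp: V_def cross_def)
    note d = F[OF this(1)] F[OF this(2)]
    have "((\<lambda>w. F (w + 2 * of_real pi * \<i>)) has_field_derivative elliptic_integrand a b c w) (at w)"
      using d(2) by (subst (asm) DERIV_shift) (simp add: elliptic_integrand_periodic)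
    from DERIV_diff[OF this d(1)] show ?thesis
      by (auto intro: has_field_derivative_at_within)
  qed
  ultimately obtain K where K: "\<And>w. w \<in> V \<Longrightarrow> F (w + 2 * of_real pi * \<i>) - F w = K"
    using has_field_derivative_zero_constant[of V "\<lambda>w. F (w + 2 * of_real pi * \<i>) - F w"] by blast
  have "K \<noteq> 0"
  proof
    assume "K = 0"
    define k where "k t = (c + b\<^sup>2 * (sin t)\<^sup>2) / sqrt (a\<^sup>2 - b\<^sup>2 * (sin t)\<^sup>2)" for t
    have d: "((\<lambda>t. Im (F (\<i> * of_real t))) has_real_derivative k t) (at t)" for t
    proof -
      have "\<i> * of_real t \<in> cross r" using r by (simp add: cross_def)
      from F[OF this] have "((F \<circ> (\<lambda>t. \<i> * of_real t)) has_vector_derivative (\<i> * of_real (k t))) (at t)"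
        by (intro field_vector_diff_chain_at)
           (auto intro!: derivative_eq_intros simp: elliptic_integrand_imaginary[OF ab] k_def)
      then have "((\<lambda>t. Im (F (\<i> * of_real t))) has_vector_derivative Im (\<i> * of_real (k t))) (at t)"
        unfolding o_def by (rule bounded_linear.has_vector_derivative[OF bounded_linear_Im])
      then show ?thesis by (simp add: has_real_derivative_iff_has_vector_derivative)
    qed
    have "F (\<i> * of_real (2 * pi)) = F (\<i> * of_real 0)"
      using K[of 0] \<open>K = 0\<close> r by (simp add: V_def mult_ac)
    then have eq: "Im (F (\<i> * of_real 0)) = Im (F (\<i> * of_real (2 * pi)))" by simp
    have cont: "continuous_on {0..2 * pi} (\<lambda>t. Im (F (\<i> * of_real t)))"
      using d by (intro continuous_at_imp_continuous_on ballI) (blast intro: DERIV_isCont)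
    obtain t where "k t = 0"
      using Rolle_deriv[of 0 "2 * pi" "\<lambda>t. Im (F (\<i> * of_real t))" "\<lambda>t. (*) (k t)"] eq cont d
      by (auto simp: has_field_derivative_def fun_eq_iff)
    then show False
      using c[of t] elliptic_integrand_imaginary(2)[OF ab, of t] by (simp add: k_def)
  qed
  moreover have "F (w + 2 * of_real pi * \<i>) = F w + K" if "\<bar>Re w\<bar> < r" for w
    using K[of w] that by (simp add: V_def algebra_simps)
  ultimately show ?thesis using r F that by blast
qed

section \<open>Polynomial relations along a curve with quasi-periodic height\<close>

text \<open>
  Continue the relation from \<open>T\<close> to the whole cross, then translate by multiples of \<open>2 * pi * \<i>\<close>: the
  horizontal coordinates do not change, while the height moves by \<open>l * K \<noteq> 0\<close> each time.  For fixed
  horizontal coordinates the polynomial in the height thus has infinitely many zeros and vanishes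
  identically.  As \<open>w\<close> runs over a real neighbourhood of 0 and \<open>\<theta>\<close> over its interval, these coordinates
  contain an open square, so the polynomial is zero.
\<close>
lemma relation_with_quasi_periodic_height_is_trivial:
  fixes F :: "complex \<Rightarrow> complex" and \<kappa> :: real
  assumes "r > 0" "K \<noteq> 0" "l \<noteq> 0" "\<kappa> \<noteq> 0"
    and F: "F holomorphic_on cross r"
    and period: "\<forall>w. \<bar>Re w\<bar> < r \<longrightarrow> F (w + 2 * of_real pi * \<i>) = F w + K"
    and T: "connected T" "t \<in> T" "\<And>x. T \<noteq> {x}"
    and rel: "\<And>\<tau> \<theta>. \<tau> \<in> T \<Longrightarrow> \<theta> \<in> {0<..<2 * pi} \<Longrightarrow>
      cpoly3 P (of_real (\<kappa> * sinh \<tau> * cos \<theta>)) (of_real (\<kappa> * sinh \<tau> * sin \<theta>)) (C + l * F (of_real \<tau>)) = 0"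
  shows "P = 0"
proof -
  define X where "X \<theta> w = of_real \<kappa> * sinh w * of_real (cos \<theta>)" for \<theta> and w :: complex
  define Y where "Y \<theta> w = of_real \<kappa> * sinh w * of_real (sin \<theta>)" for \<theta> and w :: complex
  have continued: "cpoly3 P (X \<theta> w) (Y \<theta> w) (C + l * F w) = 0"
    if \<theta>: "\<theta> \<in> {0<..<2 * pi}" and w: "w \<in> cross r" for \<theta> w
  proof (rule analytic_continuation[of "\<lambda>w. cpoly3 P (X \<theta> w) (Y \<theta> w) (C + l * F w)" _ "of_real ` T" "of_real t"])
    show "(\<lambda>w. cpoly3 P (X \<theta> w) (Y \<theta> w) (C + l * F w)) holomorphic_on cross r"
      unfolding X_def Y_def
      by (intro holomorphic_on_cpoly3 holomorphic_intros holomorphic_on_sinh F)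
    show "open (cross r)" by (rule open_cross)
    show "connected (cross r)" by (intro starlike_imp_connected starlike_cross assms)
    show "complex_of_real ` T \<subseteq> cross r" by (auto simp: cross_def)
    show "complex_of_real t \<in> cross r" by (auto simp: cross_def)
    show "complex_of_real t islimpt complex_of_real ` T"
    proof (rule connected_imp_perfect)
      show "connected (complex_of_real ` T)"
        by (intro connected_continuous_image continuous_intros T)
      show "complex_of_real t \<in> complex_of_real ` T" using T by simp
      show "complex_of_real ` T \<noteq> {x}" for x
      proof
        assume *: "complex_of_real ` T = {x}"
        have "\<tau> = t" if "\<tau> \<in> T" for \<tau>
        proof -
          have "complex_of_real \<tau> \<in> {x}" "complex_of_real t \<in> {x}"
            using that T(2) unfolding *[symmetric] by simp_all
          then show ?thesis using of_real_eq_iff by (metis singletonD)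
        qed
        then have "T = {t}" using T(2) by blast
        with T(3) show False by blast
      qed
    qed
    show "w \<in> cross r" by fact
    show "cpoly3 P (X \<theta> v) (Y \<theta> v) (C + l * F v) = 0" if "v \<in> complex_of_real ` T" for v
      using that rel[OF _ \<theta>] by (auto simp: X_def Y_def sinh_of_real)
  qed
  have all_heights: "cpoly3 P (X \<theta> w) (Y \<theta> w) Z = 0"
    if \<theta>: "\<theta> \<in> {0<..<2 * pi}" and w: "\<bar>Re w\<bar> < r" for \<theta> w Z
  proof (rule cpoly3_eq_0_if_infinitely_many_zeros)
    define v where "v k = w + of_nat k * (2 * of_real pi * \<i>)" for k :: nat
    have v_Suc: "v (Suc k) = v k + 2 * of_real pi * \<i>" for k
      by (simp add: v_def algebra_simps)
    have Re_v: "\<bar>Re (v k)\<bar> < r" for k using w by (simp add: v_def)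
    have F_Suc: "F (v (Suc k)) = F (v k) + K" for k
      unfolding v_Suc using period Re_v by blast
    have F_v: "F (v k) = F w + of_nat k * K" for k
      by (induction k) (simp_all add: F_Suc v_def[of 0] algebra_simps)
    have sinh_v: "sinh (v k) = sinh w" for k
      by (induction k) (simp_all add: v_Suc sinh_plus_2pi_i v_def[of 0])
    have "C + l * F (v k) \<in> {Z. cpoly3 P (X \<theta> w) (Y \<theta> w) Z = 0}" for k
      using continued[OF \<theta>, of "v k"] Re_v[of k] by (simp add: X_def Y_def sinh_v cross_def)
    then have "range (\<lambda>k. C + l * F (v k)) \<subseteq> {Z. cpoly3 P (X \<theta> w) (Y \<theta> w) Z = 0}" by blast
    moreover have "inj (\<lambda>k. C + l * F (v k))"
      using assms by (auto simp: inj_def F_v)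
    then have "infinite (range (\<lambda>k. C + l * F (v k)))"
      by (rule range_inj_infinite)
    ultimately show "infinite {Z. cpoly3 P (X \<theta> w) (Y \<theta> w) Z = 0}"
      using finite_subset by blast
  qed
  \<comment> \<open>The square of side \<open>\<delta>\<close> lies in the disc of radius \<open>\<bar>\<kappa>\<bar> * sinh r\<close> swept by the real part of the
    vertical strip, and it avoids the excluded direction \<open>\<theta> = 0\<close>.\<close>
  define \<delta> where "\<delta> = \<bar>\<kappa>\<bar> * sinh r / 2"
  have \<delta>: "\<delta> > 0" using assms by (simp add: \<delta>_def)
  show ?thesis
  proof (rule poly3_vanishing_on_box_is_zero)
    show "infinite {0<..<\<delta>}" "infinite {0<..<\<delta>}" "infinite (UNIV :: real set)"
      using \<delta> by (auto simp: infinite_UNIV_char_0)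
    fix x y z assume x: "x \<in> {0<..<\<delta>}" and y: "y \<in> {0<..<\<delta>}"
    define \<rho> where "\<rho> = sqrt (x\<^sup>2 + y\<^sup>2)"
    have \<rho>: "\<rho> > 0" using x y by (simp add: \<rho>_def add_pos_pos)
    have "\<rho> \<le> x + y" unfolding \<rho>_def using x y by (intro sqrt_sum_squares_le_sum) auto
    then have \<rho>_less: "\<rho> < \<bar>\<kappa>\<bar> * sinh r" using x y by (simp add: \<delta>_def)
    have "(x / \<rho>)\<^sup>2 + (y / \<rho>)\<^sup>2 = 1"
    proof -
      have "\<rho>\<^sup>2 = x\<^sup>2 + y\<^sup>2" by (simp add: \<rho>_def)
      then show ?thesis using x \<rho> by (simp add: power_divide flip: add_divide_distrib)
    qed
    then obtain \<theta> where \<theta>: "0 \<le> \<theta>" "\<theta> < 2 * pi" "x / \<rho> = cos \<theta>" "y / \<rho> = sin \<theta>"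
      by (rule sincos_total_2pi)
    have "\<theta> \<noteq> 0" using \<theta> y \<rho> by auto
    define \<tau> where "\<tau> = arsinh (\<rho> / \<kappa>)"
    have "\<bar>sinh \<tau>\<bar> = \<rho> / \<bar>\<kappa>\<bar>" using \<rho> by (simp add: \<tau>_def)
    also have "\<dots> < sinh r" using \<rho>_less assms by (simp add: field_simps)
    finally have "\<bar>\<tau>\<bar> < r" by (simp flip: sinh_real_abs)
    then have "cpoly3 P (X \<theta> (of_real \<tau>)) (Y \<theta> (of_real \<tau>)) (of_real z) = 0"
      using all_heights[of \<theta> "of_real \<tau>"] \<theta> \<open>\<theta> \<noteq> 0\<close> by simp
    moreover have "\<kappa> * sinh \<tau> = \<rho>" using assms by (simp add: \<tau>_def)
    then have "X \<theta> (of_real \<tau>) = of_real x" "Y \<theta> (of_real \<tau>) = of_real y"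
      using \<theta>(3,4) \<rho> by (simp_all add: X_def Y_def sinh_of_real field_simps flip: of_real_mult)
    ultimately show "poly3 P (vector [x, y, z]) = 0"
      by (simp add: cpoly3_of_real)
  qed
qed

section \<open>The profile curve as an elliptic integral\<close>

text \<open>
  The parameter \<open>\<tau>\<close> is chosen so that \<open>(1 - B)\<^sup>2 * (sinh \<tau>)\<^sup>2 = R\<close>.  In terms of \<open>s\<close>, the two quadratic factors
  under the root of the elliptic integral are squares:
  \<open>R + (1 + B)\<^sup>2 = 4 * B * (cosh (H * s))\<^sup>2\<close> and \<open>R + (1 - B)\<^sup>2 = 4 * B * (sinh (H * s))\<^sup>2\<close>.
  The second is what makes the derivative of \<open>\<tau>\<close> simple, and taking its root produces the sign of \<open>s\<close>;
  the first is the radicand of the elliptic integrand.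
\<close>
lemma profile_derivatives:
  fixes H B :: real
  defines "R \<equiv> \<lambda>s. 2 * B * cosh (2 * H * s) - B\<^sup>2 - 1"
  defines "\<tau> \<equiv> \<lambda>s. arsinh (sqrt (R s) / \<bar>1 - B\<bar>)"
  defines "D \<equiv> \<lambda>s. 2 * sqrt B * H * sgn s * cosh (H * s) / sqrt (R s)"
  assumes "H > 0" "B > 0" "B \<noteq> 1" and R: "R s > 0"
  shows "(1 - B * cosh (2 * H * s)) / sqrt (R s) = sgn s / (2 * H) *
      (((1 - B\<^sup>2) - \<bar>1 - B\<bar>\<^sup>2 * (sinh (\<tau> s))\<^sup>2) / sqrt ((1 + B)\<^sup>2 + \<bar>1 - B\<bar>\<^sup>2 * (sinh (\<tau> s))\<^sup>2)) *
      D s"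
    and "(\<tau> has_real_derivative D s) (at s)"
proof -
  have "s \<noteq> 0"
  proof
    assume "s = 0"
    then have "R s = - (B - 1)\<^sup>2" by (simp add: R_def power2_eq_square algebra_simps)
    then show False using R by simp
  qed
  have s2: "sgn s * sgn s = 1" using \<open>s \<noteq> 0\<close> by (simp add: sgn_if)
  have sinh_\<tau>: "\<bar>1 - B\<bar>\<^sup>2 * (sinh (\<tau> s))\<^sup>2 = R s"
    using assms by (simp add: \<tau>_def power_divide)
  have C2: "cosh (2 * H * s) = 2 * (cosh (H * s))\<^sup>2 - 1"
    using cosh_double_cosh[of "H * s"] by (simp add: mult.assoc)
  have "(1 + B)\<^sup>2 + R s = 4 * B * (cosh (H * s))\<^sup>2"
    unfolding R_def C2 by (simp add: power2_eq_square algebra_simps)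
  then have root: "sqrt ((1 + B)\<^sup>2 + R s) = 2 * sqrt B * cosh (H * s)"
    by (simp add: real_sqrt_mult)
  have num: "(1 - B\<^sup>2) - R s = 2 * (1 - B * cosh (2 * H * s))" by (simp add: R_def)
  show "(1 - B * cosh (2 * H * s)) / sqrt (R s) = sgn s / (2 * H) *
      (((1 - B\<^sup>2) - \<bar>1 - B\<bar>\<^sup>2 * (sinh (\<tau> s))\<^sup>2) / sqrt ((1 + B)\<^sup>2 + \<bar>1 - B\<bar>\<^sup>2 * (sinh (\<tau> s))\<^sup>2)) *
      D s"
    unfolding sinh_\<tau> root num D_def using assms s2 by (simp add: field_simps)
  have "R s + (1 - B)\<^sup>2 = 4 * B * (sinh (H * s))\<^sup>2"
    unfolding R_def C2 cosh_square_eq by (simp add: power2_eq_square algebra_simps)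
  moreover have "\<bar>sinh (H * s)\<bar> = sgn s * sinh (H * s)"
    using \<open>H > 0\<close> \<open>s \<noteq> 0\<close> by (auto simp: sgn_if abs_if mult_less_0_iff zero_less_mult_iff)
  ultimately have root': "sqrt (R s + (1 - B)\<^sup>2) = 2 * sqrt B * (sgn s * sinh (H * s))"
    by (simp add: real_sqrt_mult)
  have b: "sqrt ((sqrt (R s) / \<bar>1 - B\<bar>)\<^sup>2 + 1) = sqrt (R s + (1 - B)\<^sup>2) / \<bar>1 - B\<bar>"
  proof -
    have "(sqrt (R s) / \<bar>1 - B\<bar>)\<^sup>2 + 1 = (R s + (1 - B)\<^sup>2) / (1 - B)\<^sup>2"
      using R assms by (simp add: power_divide field_simps)
    then show ?thesis by (simp add: real_sqrt_divide)
  qed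
  have dR: "(R has_real_derivative 4 * B * H * sinh (2 * H * s)) (at s)"
    unfolding R_def by (auto intro!: derivative_eq_intros)
  have "(\<tau> has_real_derivative
      1 / sqrt ((sqrt (R s) / \<bar>1 - B\<bar>)\<^sup>2 + 1) * (4 * B * H * sinh (2 * H * s) / (2 * sqrt (R s)) / \<bar>1 - B\<bar>)) (at s)"
    unfolding \<tau>_def using R assms
    by (intro DERIV_chain2[OF arsinh_real_has_field_derivative] DERIV_cdivide)
       (auto intro!: derivative_eq_intros dR simp: divide_simps)
  also have "1 / sqrt ((sqrt (R s) / \<bar>1 - B\<bar>)\<^sup>2 + 1) * (4 * B * H * sinh (2 * H * s) / (2 * sqrt (R s)) / \<bar>1 - B\<bar>) = D s"
  proof -
    have "B = sqrt B * sqrt B" using assms by simp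
    moreover have "sinh (2 * H * s) = 2 * sinh (H * s) * cosh (H * s)"
      using sinh_double[of "H * s"] by (simp add: mult.assoc)
    ultimately have "4 * B * H * sinh (2 * H * s) = 8 * (sqrt B * sqrt B) * H * sinh (H * s) * cosh (H * s)"
      by simp
    then show ?thesis
      unfolding b root' D_def using assms s2 \<open>s \<noteq> 0\<close> by (simp add: divide_simps sgn_if)
  qed
  finally show "(\<tau> has_real_derivative D s) (at s)" .
qed

text \<open>
  The left-hand side is \<open>1 - B\<close> times a positive quantity.  For the hyperboloid, \<open>B = 1\<close>, it vanishes
  identically, and the period with it.
\<close>
lemma elliptic_numerator_nonzero:
  fixes B t :: real
  assumes "B > 0" "B \<noteq> 1"
  shows "1 - B\<^sup>2 + \<bar>1 - B\<bar>\<^sup>2 * (sin t)\<^sup>2 \<noteq> 0"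
proof -
  have q: "0 \<le> (sin t)\<^sup>2" "(sin t)\<^sup>2 \<le> 1" by (auto simp: abs_square_le_1)
  have "1 - B\<^sup>2 + \<bar>1 - B\<bar>\<^sup>2 * (sin t)\<^sup>2 = (1 - B) * (1 + (sin t)\<^sup>2 + B * (1 - (sin t)\<^sup>2))"
    by (simp add: power2_eq_square algebra_simps)
  moreover have "1 + (sin t)\<^sup>2 + B * (1 - (sin t)\<^sup>2) > 0"
    using q assms by (intro add_pos_nonneg) auto
  ultimately show ?thesis using assms by simp
qed

text \<open>
  Both sides of the height formula have the same derivative along the interval.  The factor \<open>l\<close> is
  constant because the interval lies on one side of 0, the radicand being negative at 0.
\<close>
lemma profile_in_elliptic_coordinates:
  fixes H B a e c :: real
  defines "\<tau> \<equiv> \<lambda>s. arsinh (sqrt (2 * B * cosh (2 * H * s) - B\<^sup>2 - 1) / \<bar>1 - B\<bar>)"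
  assumes "H > 0" "B > 0" "B \<noteq> 1" "e > 0"
    and pos: "\<forall>s\<in>{a..a + e}. 2 * B * cosh (2 * H * s) - B\<^sup>2 - 1 > 0"
    and F: "\<forall>w\<in>cross r. (F has_field_derivative elliptic_integrand (1 + B) \<bar>1 - B\<bar> (1 - B\<^sup>2) w) (at w)"
  obtains l C where "l \<noteq> 0" "continuous_on {a..a + e} \<tau>" "\<tau> a \<noteq> \<tau> (a + e)"
    "\<forall>s\<in>{a..a + e}. profile_x H B s = \<bar>1 - B\<bar> / (2 * H) * sinh (\<tau> s)"
    "\<forall>s\<in>{a..a + e}. of_real (profile_z H B a c s) = C + l * F (of_real (\<tau> s))"
proof -
  define R where "R s = 2 * B * cosh (2 * H * s) - B\<^sup>2 - 1" for s
  define J where "J = {a..a + e}"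
  have R: "R s > 0" if "s \<in> J" for s using pos that by (simp add: R_def J_def)
  have "0 \<notin> J"
  proof
    assume "0 \<in> J"
    moreover have "R 0 = - (B - 1)\<^sup>2" by (simp add: R_def power2_eq_square algebra_simps)
    ultimately show False using R[of 0] by simp
  qed
  then have side: "a > 0 \<or> a + e < 0" by (auto simp: J_def)
  have sgn: "sgn s = sgn a" if "s \<in> J" for s
    using side that \<open>e > 0\<close> by (auto simp: J_def sgn_if)
  define l :: complex where "l = of_real (sgn a / (2 * H))"
  have l: "l \<noteq> 0" using side assms by (auto simp: l_def sgn_if)
  define D where "D s = 2 * sqrt B * H * sgn s * cosh (H * s) / sqrt (R s)" for s
  define f where "f s = (1 - B * cosh (2 * H * s)) / sqrt (R s)" for s
  have \<tau>_R: "\<tau> = (\<lambda>s. arsinh (sqrt (R s) / \<bar>1 - B\<bar>))" by (simp add: \<tau>_def R_def)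
  have f_eq: "f s = sgn s / (2 * H) *
      (((1 - B\<^sup>2) - \<bar>1 - B\<bar>\<^sup>2 * (sinh (\<tau> s))\<^sup>2) / sqrt ((1 + B)\<^sup>2 + \<bar>1 - B\<bar>\<^sup>2 * (sinh (\<tau> s))\<^sup>2)) * D s"
    if "s \<in> J" for s
    unfolding \<tau>_R f_def D_def R_def
    by (rule profile_derivatives) (use assms R[OF that] in \<open>simp_all add: R_def\<close>)
  have d: "(\<tau> has_real_derivative D s) (at s)" if "s \<in> J" for s
    unfolding \<tau>_R D_def R_def
    by (rule profile_derivatives) (use assms R[OF that] in \<open>simp_all add: R_def\<close>)
  have cont: "continuous_on J \<tau>"
    using d by (intro continuous_at_imp_continuous_on ballI) (blast intro: DERIV_isCont)
  have cont_f: "continuous_on J f"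
  proof -
    have "continuous_on J R" unfolding R_def by (intro continuous_intros)
    moreover have "\<forall>s\<in>J. sqrt (R s) \<noteq> 0" using R by fastforce
    ultimately show ?thesis unfolding f_def by (intro continuous_intros)
  qed
  have dz: "((\<lambda>s. profile_z H B a c s) has_vector_derivative f s) (at s within J)" if "s \<in> J" for s
  proof -
    have "((\<lambda>u. LBINT y=ereal a..ereal u. f y) has_vector_derivative f s) (at s within {a..a + e})"
      using that \<open>e > 0\<close> cont_f by (intro interval_integral_FTC2) (auto simp: J_def)
    then have "((\<lambda>u. c + (LBINT y=ereal a..ereal u. f y)) has_vector_derivative 0 + f s) (at s within J)"
      unfolding J_def by (intro has_vector_derivative_add has_vector_derivative_const)
    then show ?thesis by (simp add: profile_z_def f_def R_def)
  qed
  have "((\<lambda>s. of_real (profile_z H B a c s) - l * F (of_real (\<tau> s))) has_vector_derivative 0) (at s within J)"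
    if s: "s \<in> J" for s
  proof -
    have d\<tau>: "((\<lambda>s. complex_of_real (\<tau> s)) has_vector_derivative of_real (D s)) (at s within J)"
      using d[OF s] 
      by (intro has_vector_derivative_of_real) (simp add: has_real_derivative_iff_has_vector_derivative has_vector_derivative_at_within)
    have dF: "(F has_field_derivative elliptic_integrand (1 + B) \<bar>1 - B\<bar> (1 - B\<^sup>2) (of_real (\<tau> s)))
        (at (of_real (\<tau> s)) within (\<lambda>s. of_real (\<tau> s)) ` J)"
      by (rule has_field_derivative_at_within[OF F[rule_format]]) (simp add: cross_def)
    have dF\<tau>: "((\<lambda>s. F (of_real (\<tau> s))) has_vector_derivative
        of_real (D s) * elliptic_integrand (1 + B) \<bar>1 - B\<bar> (1 - B\<^sup>2) (of_real (\<tau> s))) (at s within J)"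
      using field_vector_diff_chain_within[OF d\<tau> dF] by (simp only: o_def)
    have dz': "((\<lambda>s. complex_of_real (profile_z H B a c s)) has_vector_derivative of_real (f s)) (at s within J)"
      using dz[OF s] by (intro has_vector_derivative_of_real) (simp add: has_real_derivative_iff_has_vector_derivative)
    have "complex_of_real (f s) - l * (of_real (D s) * elliptic_integrand (1 + B) \<bar>1 - B\<bar> (1 - B\<^sup>2) (of_real (\<tau> s))) = 0"
      unfolding f_eq[OF s] elliptic_integrand_of_real l_def sgn[OF s]
      by (simp only: of_real_mult mult_ac diff_self)
    then show ?thesis
      using has_vector_derivative_diff[OF dz' has_vector_derivative_mult_right[OF dF\<tau>, of l]] by simp
  qed
  then obtain C where C: "\<And>s. s \<in> J \<Longrightarrow> of_real (profile_z H B a c s) - l * F (of_real (\<tau> s)) = C"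
    by (rule has_vector_derivative_zero_constant[rotated]) (auto simp: J_def)
  have x: "profile_x H B s = \<bar>1 - B\<bar> / (2 * H) * sinh (\<tau> s)" for s
    using assms by (simp add: profile_x_def \<tau>_def)
  have "\<tau> a \<noteq> \<tau> (a + e)"
  proof
    assume "\<tau> a = \<tau> (a + e)"
    then have "sinh (\<tau> a) = sinh (\<tau> (a + e))" by simp
    then have "cosh (2 * H * a) = cosh (2 * H * (a + e))" using assms by (simp add: \<tau>_def)
    then have "2 * H * \<bar>a\<bar> = 2 * H * \<bar>a + e\<bar>" using assms by (simp add: abs_mult)
    then show False using side assms by auto
  qed
  moreover have "of_real (profile_z H B a c s) = C + l * F (of_real (\<tau> s))" if "s \<in> J" for s
    using C[OF that] by (simp add: algebra_simps)
  ultimately show ?thesis using that l cont x unfolding J_def by blast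
qed

section \<open>The surfaces are not algebraic\<close>

theorem theorem3p2:
  fixes H B a c :: real and I :: "real set"
  assumes "H > 0" and "B > 0" and "B \<noteq> 1"
    and "open I" and "is_interval I" and "a \<in> I"
    and "\<forall>s\<in>I. profile_x H B s > 0"
  shows "\<not> algebraic_surface (rotation_surface (profile_x H B) (profile_z H B a c) I) \<and>
    (\<forall>S. rotation_surface (profile_x H B) (profile_z H B a c) I \<subseteq> S \<longrightarrow> \<not> algebraic_surface S)"
proof -
  have "\<not> algebraic_surface S"
    if sub: "rotation_surface (profile_x H B) (profile_z H B a c) I \<subseteq> S" for S
  proof
    assume "algebraic_surface S"
    then obtain P where P: "P \<noteq> 0" "S = {p. poly3 P p = 0}"
      by (auto simp: algebraic_surface_def)
    obtain e where e: "e > 0" "{a..a + e} \<subseteq> I"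
    proof -
      obtain e where "e > 0" "cball a e \<subseteq> I"
        using \<open>open I\<close> \<open>a \<in> I\<close> open_contains_cball by blast
      moreover have "{a..a + e} \<subseteq> cball a e" by (auto simp: dist_real_def)
      ultimately show ?thesis using that by blast
    qed
    have pos: "\<forall>s\<in>{a..a + e}. 2 * B * cosh (2 * H * s) - B\<^sup>2 - 1 > 0"
      using assms(7) e \<open>H > 0\<close> by (auto simp: profile_x_def zero_less_mult_iff zero_less_divide_iff)
    define \<tau> where "\<tau> s = arsinh (sqrt (2 * B * cosh (2 * H * s) - B\<^sup>2 - 1) / \<bar>1 - B\<bar>)" for s
    have ab: "0 < \<bar>1 - B\<bar>" "\<bar>1 - B\<bar> < 1 + B" using assms by auto
    obtain r K F where F: "r > 0" "K \<noteq> 0"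
      "\<forall>w\<in>cross r. (F has_field_derivative elliptic_integrand (1 + B) \<bar>1 - B\<bar> (1 - B\<^sup>2) w) (at w)"
      "\<forall>w. \<bar>Re w\<bar> < r \<longrightarrow> F (w + 2 * of_real pi * \<i>) = F w + K"
      by (rule elliptic_primitive_with_period[OF ab elliptic_numerator_nonzero[OF assms(2,3)]])
    obtain l C where l: "l \<noteq> 0" and cont: "continuous_on {a..a + e} \<tau>" and ne: "\<tau> a \<noteq> \<tau> (a + e)"
      and x: "\<forall>s\<in>{a..a + e}. profile_x H B s = \<bar>1 - B\<bar> / (2 * H) * sinh (\<tau> s)"
      and z: "\<forall>s\<in>{a..a + e}. of_real (profile_z H B a c s) = C + l * F (of_real (\<tau> s))"
      unfolding \<tau>_def
      by (rule profile_in_elliptic_coordinates[OF assms(1-3) e(1) pos F(3)])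
    have "P = 0"
    proof (rule relation_with_quasi_periodic_height_is_trivial[OF F(1,2) l _ _ F(4)])
      show "\<bar>1 - B\<bar> / (2 * H) \<noteq> 0" using assms by simp
      show "F holomorphic_on cross r"
        using F(3) holomorphic_on_open[OF open_cross] by blast
      show "connected (\<tau> ` {a..a + e})"
        by (intro connected_continuous_image cont connected_Icc)
      show "\<tau> a \<in> \<tau> ` {a..a + e}" using e by simp
      show "\<tau> ` {a..a + e} \<noteq> {x}" for x
      proof
        assume "\<tau> ` {a..a + e} = {x}"
        moreover have "\<tau> a \<in> \<tau> ` {a..a + e}" "\<tau> (a + e) \<in> \<tau> ` {a..a + e}" using e by auto
        ultimately show False using ne by simp
      qed
      fix t \<theta> assume "t \<in> \<tau> ` {a..a + e}" and \<theta>: "\<theta> \<in> {0<..<2 * pi}"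
      then obtain s where s: "s \<in> {a..a + e}" "t = \<tau> s" by blast
      have "vector [profile_x H B s * cos \<theta>, profile_x H B s * sin \<theta>, profile_z H B a c s] \<in> S"
        using sub s \<theta> e(2) by (fastforce simp: rotation_surface_def)
      then have "poly3 P (vector [profile_x H B s * cos \<theta>, profile_x H B s * sin \<theta>, profile_z H B a c s]) = 0"
        by (simp add: P)
      then show "cpoly3 P (of_real (\<bar>1 - B\<bar> / (2 * H) * sinh t * cos \<theta>))
          (of_real (\<bar>1 - B\<bar> / (2 * H) * sinh t * sin \<theta>)) (C + l * F (of_real t)) = 0"
        unfolding s(2) bspec[OF x s(1), symmetric] bspec[OF z s(1), symmetric] cpoly3_of_real by simp
    qed
    with P show False by simp
  qed
  then show ?thesis by blast
qed

end
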